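(* For every integer $n\ge 4$ and every integer $\Delta$ with $\lceil (n+2)/2\rceil\le \Delta\le n-1$, there exists a strong bicentral $2$-tree on $n$ vertices with maximum degree $\Delta$ and tail set $\{2,3\}$.
   Context: A $2$-tree is a graph obtained from the triangle $K_3$ by repeatedly adding a new vertex adjacent to both endpoints of an existing edge. For $r\in\{1,2,3\}$ and an integer $\Delta\ge 2$, a $2$-tree on $n$ vertices is $r$-central with maximum degree $\Delta$ if $\Delta$ is its maximum degree and exactly $r$ vertices have degree $\Delta$; these $r$ vertices form the core and the other $n-r$ vertices form the tail. It is strong if the core induces $K_r$. It has tail set $\{2,3\}$ if every tail vertex has degree $2$ or $3$. "Bicentral" means $2$-central. *)

theory Defs
  imports Complex_Main "Graph_Theory.Graph_Theory"
begin

(* Finite simple graphs are pair_graphs of Graph_Theory, i.e. finite loop-free digraphs with a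
   symmetric set of arcs: the undirected edge uv is the pair of arcs (u,v), (v,u). *)

inductive two_tree :: "'a pair_pre_digraph \<Rightarrow> bool" where
  triangle: "complete_digraph 3 (with_proj G) \<Longrightarrow> two_tree G"
| extend: "\<lbrakk>two_tree G; (u, v) \<in> parcs G; w \<notin> pverts G\<rbrakk> \<Longrightarrow>
    two_tree \<lparr>pverts = insert w (pverts G),
              parcs = parcs G \<union> {(w, u), (u, w), (w, v), (v, w)}\<rparr>"

lemma two_tree_imp_pair_graph: "two_tree G \<Longrightarrow> pair_graph G"
proof (induction rule: two_tree.induct)
  case (triangle G)
  then show ?case by (rule pair_graphI_complete)
next
  case (extend G u v w)
  interpret pair_graph G by (rule extend.IH)
  have uv: "u \<in> pverts G" "v \<in> pverts G"
    using extend.hyps by (auto dest: in_arcsD1 in_arcsD2)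
  have "sym (parcs G)"
    using pair_sym_arcs by (simp add: symmetric_def)
  then have "sym (parcs G \<union> {(w, u), (u, w), (w, v), (v, w)})"
    by (auto simp: sym_def)
  then show ?case
    using uv extend.hyps pair_finite_verts pair_finite_arcs pair_no_loops
    by unfold_locales (auto simp: symmetric_def dest: in_arcsD1 in_arcsD2)
qed

(* Each undirected edge at v contributes exactly one arc leaving v. *)
definition vertex_degree :: "'a pair_pre_digraph \<Rightarrow> 'a \<Rightarrow> nat" where
  "vertex_degree G v = out_degree (with_proj G) v"

definition max_degree :: "'a pair_pre_digraph \<Rightarrow> nat" where
  "max_degree G = Max (vertex_degree G ` pverts G)"

definition core_verts :: "'a pair_pre_digraph \<Rightarrow> 'a set" where
  "core_verts G = {v \<in> pverts G. vertex_degree G v = max_degree G}"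

definition tail_verts :: "'a pair_pre_digraph \<Rightarrow> 'a set" where
  "tail_verts G = pverts G - core_verts G"

definition central_two_tree :: "nat \<Rightarrow> nat \<Rightarrow> nat \<Rightarrow> 'a pair_pre_digraph \<Rightarrow> bool" where
  "central_two_tree r n \<Delta> G \<longleftrightarrow> r \<in> {1, 2, 3} \<and> 2 \<le> \<Delta> \<and> two_tree G \<and> card (pverts G) = n
    \<and> max_degree G = \<Delta> \<and> card (core_verts G) = r"

abbreviation bicentral_two_tree :: "nat \<Rightarrow> nat \<Rightarrow> 'a pair_pre_digraph \<Rightarrow> bool" where
  "bicentral_two_tree \<equiv> central_two_tree 2"

definition strong :: "'a pair_pre_digraph \<Rightarrow> bool" where
  "strong G \<longleftrightarrow>
    complete_digraph (card (core_verts G)) (induce_subgraph (with_proj G) (core_verts G))"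

(* The tail degrees need only lie in S; not every element of S has to occur. *)
definition has_tail_set :: "'a pair_pre_digraph \<Rightarrow> nat set \<Rightarrow> bool" where
  "has_tail_set G S \<longleftrightarrow> (\<forall>v \<in> tail_verts G. vertex_degree G v \<in> S)"

end

theory Submission
  imports Defs
begin

text \<open>Start from two triangles sharing the edge 01. A page, i.e. a new vertex on 01, raises both
  core degrees by one and adds a tail vertex of degree 2. Keep a degree-2 neighbour a of 0 and b
  of 1; placing one new vertex on 0a and one on 1b also raises both core degrees by one, costs two
  vertices, and turns a and b into vertices of degree 3 whose role is taken over by the new
  vertices. With s steps of the second kind and t pages one gets n = 4 + t + 2s and
  \<Delta> = 3 + t + s, i.e. s = n - 1 - \<Delta> and t = 2\<Delta> - n - 2.\<close>

definition add_ear :: "'a \<Rightarrow> 'a \<Rightarrow> 'a \<Rightarrow> 'a pair_pre_digraph \<Rightarrow> 'a pair_pre_digraph" where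
  "add_ear u v w G = \<lparr>pverts = insert w (pverts G),
     parcs = parcs G \<union> {(w, u), (u, w), (w, v), (v, w)}\<rparr>"

lemma add_ear_simps [simp]:
  "pverts (add_ear u v w G) = insert w (pverts G)"
  "parcs (add_ear u v w G) = parcs G \<union> {(w, u), (u, w), (w, v), (v, w)}"
  by (simp_all add: add_ear_def)

lemma two_tree_add_ear:
  "two_tree G \<Longrightarrow> (u, v) \<in> parcs G \<Longrightarrow> w \<notin> pverts G \<Longrightarrow> two_tree (add_ear u v w G)"
  unfolding add_ear_def by (rule two_tree.extend)

lemma vertex_degree_eq_card: "vertex_degree G x = card {y. (x, y) \<in> parcs G}"
proof -
  have "out_arcs (with_proj G) x = Pair x ` {y. (x, y) \<in> parcs G}"
    by (auto simp: out_arcs_def)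
  then show ?thesis
    by (simp add: vertex_degree_def out_degree_def card_image inj_on_def)
qed

text \<open>Arcs have no loops and \<open>w\<close> is fresh, so \<open>u\<close>, \<open>v\<close>,
  \<open>w\<close> are distinct: the neighbours of \<open>w\<close> are exactly the two vertices
  \<open>u\<close> and \<open>v\<close>, each of which gains the single neighbour
  \<open>w\<close>.\<close>

lemma vertex_degree_add_ear:
  assumes G: "pair_graph G" and uv: "(u, v) \<in> parcs G" and w: "w \<notin> pverts G"
  shows "vertex_degree (add_ear u v w G) x =
    (if x = w then 2 else vertex_degree G x + (if x = u \<or> x = v then 1 else 0))"
proof -
  interpret pair_graph G by (rule G)
  have fin: "finite {y. (x, y) \<in> parcs G}"
    by (rule finite_subset[OF _ pair_finite_verts]) (auto dest: in_arcsD2)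
  have ne: "u \<noteq> v" "u \<noteq> w" "v \<noteq> w"
    using uv w pair_no_loops[OF uv] by (auto dest: in_arcsD1 in_arcsD2)
  have wx: "(x, w) \<notin> parcs G" "(w, x) \<notin> parcs G" for x
    using w by (auto dest: in_arcsD1 in_arcsD2)
  consider "x = w" | "x = u \<or> x = v" | "x \<noteq> w" "x \<noteq> u" "x \<noteq> v" by blast
  then show ?thesis
  proof cases
    case 1
    then have "{y. (x, y) \<in> parcs (add_ear u v w G)} = {u, v}"
      using wx ne by auto
    with 1 ne show ?thesis by (simp add: vertex_degree_eq_card)
  next
    case 2
    then have "{y. (x, y) \<in> parcs (add_ear u v w G)} = insert w {y. (x, y) \<in> parcs G}"
      using ne by auto
    with 2 ne wx fin show ?thesis by (auto simp: vertex_degree_eq_card)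
  next
    case 3
    then show ?thesis by (simp add: vertex_degree_eq_card)
  qed
qed

text \<open>The induction invariant, with 0 and 1 as the future core. Taking \<open>{..<n}\<close>
  as vertex set makes \<open>n\<close> and \<open>Suc n\<close> fresh names. The strict bound by
  \<open>d\<close> keeps every other vertex out of the core, and \<open>a \<noteq> b\<close>
  prevents a later extension from raising one tail vertex to degree 4.\<close>

definition double_fan :: "nat \<Rightarrow> nat \<Rightarrow> nat \<Rightarrow> nat \<Rightarrow> nat pair_pre_digraph \<Rightarrow> bool" where
  "double_fan n d a b G \<longleftrightarrow> two_tree G \<and> pverts G = {..<n}
    \<and> (0, 1) \<in> parcs G \<and> (0, a) \<in> parcs G \<and> (1, b) \<in> parcs G
    \<and> a \<notin> {0, 1} \<and> b \<notin> {0, 1} \<and> a \<noteq> b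
    \<and> vertex_degree G 0 = d \<and> vertex_degree G 1 = d
    \<and> vertex_degree G a = 2 \<and> vertex_degree G b = 2
    \<and> (\<forall>v \<in> {2..<n}. vertex_degree G v \<in> {2, 3} \<and> vertex_degree G v < d)"

text \<open>The triangle has only one vertex besides 0 and 1, hence no room for distinct
  \<open>a\<close> and \<open>b\<close>. A second triangle on the edge 01 supplies it: 2 and 3 are
  both adjacent to 0 and to 1.\<close>

lemma double_fan_base: "\<exists>G. double_fan 4 3 2 3 G"
proof -
  define T :: "nat pair_pre_digraph" where
    "T = \<lparr>pverts = {0, 1, 2}, parcs = {(0, 1), (1, 0), (0, 2), (2, 0), (1, 2), (2, 1)}\<rparr>"
  have "complete_digraph 3 (with_proj T)"
    unfolding complete_digraph_pair_def by (auto simp: T_def)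
  then have T: "two_tree T" by (rule two_tree.triangle)
  have arc: "(0, 1) \<in> parcs T" and new: "3 \<notin> pverts T" by (simp_all add: T_def)
  have T_deg: "vertex_degree T 0 = 2" "vertex_degree T 1 = 2" "vertex_degree T 2 = 2"
    by (simp_all add: vertex_degree_eq_card T_def Collect_disj_eq)
  note deg = vertex_degree_add_ear[OF two_tree_imp_pair_graph[OF T] arc new]
  have "{2..<4} = {2, 3::nat}" "insert 3 (pverts T) = {..<4}"
    by (auto simp: T_def)
  moreover have "(0, 2) \<in> parcs T" by (simp add: T_def)
  ultimately have "double_fan 4 3 2 3 (add_ear 0 1 3 T)"
    using arc T_deg two_tree_add_ear[OF T arc new] unfolding double_fan_def deg
    by simp
  then show ?thesis ..
qed

lemma double_fan_page:
  assumes "double_fan n d a b G"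
  shows "double_fan (Suc n) (Suc d) a b (add_ear 0 1 n G)"
proof -
  have F: "two_tree G" "pverts G = {..<n}" "(0, 1) \<in> parcs G" "(0, a) \<in> parcs G" "(1, b) \<in> parcs G"
    "a \<notin> {0, 1}" "b \<notin> {0, 1}" "a \<noteq> b" "vertex_degree G 0 = d" "vertex_degree G 1 = d"
    "vertex_degree G a = 2" "vertex_degree G b = 2"
    "v \<in> {2..<n} \<Longrightarrow> vertex_degree G v \<in> {2, 3} \<and> vertex_degree G v < d" for v
    using assms unfolding double_fan_def by blast+
  have G: "pair_graph G" by (rule two_tree_imp_pair_graph) (rule F)
  interpret pair_graph G by (rule G)
  have lt: "a < n" "b < n" "1 < n"
    using F(2,4,5) in_arcsD2 F(3) by blast+
  \<comment> \<open>\<open>a\<close> lies in \<open>{2..<n}\<close> and has degree 2, so the strict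
    bound applies to it.\<close>
  have "2 < d" using F(6,11) F(13)[of a] lt by auto
  have "n \<notin> pverts G" using F(2) by simp
  note deg = vertex_degree_add_ear[OF G F(3) this]
  have "vertex_degree (add_ear 0 1 n G) v \<in> {2, 3} \<and> vertex_degree (add_ear 0 1 n G) v < Suc d"
    if "v \<in> {2..<Suc n}" for v
    using that F(13)[of v] \<open>2 < d\<close> unfolding deg by (cases "v = n") auto
  moreover have "insert n {..<n} = {..<Suc n}" by auto
  ultimately show ?thesis
    using F(2-12) lt two_tree_add_ear[OF F(1,3) \<open>n \<notin> pverts G\<close>]
    unfolding double_fan_def deg by simp
qed

text \<open>The ear on \<open>0a\<close> makes \<open>n\<close> a neighbour of 0, the ear on
  \<open>1b\<close> makes \<open>Suc n\<close> a neighbour of 1, and both have degree 2, so they can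
  replace \<open>a\<close> and \<open>b\<close>.\<close>

lemma double_fan_extend:
  assumes "double_fan n d a b G"
  shows "double_fan (n + 2) (Suc d) n (Suc n) (add_ear 1 b (Suc n) (add_ear 0 a n G))"
proof -
  have F: "two_tree G" "pverts G = {..<n}" "(0, 1) \<in> parcs G" "(0, a) \<in> parcs G" "(1, b) \<in> parcs G"
    "a \<notin> {0, 1}" "b \<notin> {0, 1}" "a \<noteq> b" "vertex_degree G 0 = d" "vertex_degree G 1 = d"
    "vertex_degree G a = 2" "vertex_degree G b = 2"
    "v \<in> {2..<n} \<Longrightarrow> vertex_degree G v \<in> {2, 3} \<and> vertex_degree G v < d" for v
    using assms unfolding double_fan_def by blast+
  have G: "pair_graph G" by (rule two_tree_imp_pair_graph) (rule F)
  interpret pair_graph G by (rule G)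
  have lt: "a < n" "b < n" "1 < n"
    using F(2,4,5) in_arcsD2 F(3) by blast+
  \<comment> \<open>Needed for \<open>a\<close> and \<open>b\<close>: their degree rises to 3, which
    must stay below \<open>Suc d\<close>.\<close>
  have "2 < d" using F(6,11) F(13)[of a] lt by auto
  let ?H = "add_ear 0 a n G"
  let ?K = "add_ear 1 b (Suc n) ?H"
  have n: "n \<notin> pverts G" using F(2) by simp
  have H: "two_tree ?H" by (rule two_tree_add_ear[OF F(1,4) n])
  have arc: "(1, b) \<in> parcs ?H" using F(5) by simp
  have Sn: "Suc n \<notin> pverts ?H" using F(2) by simp
  \<comment> \<open>The edges \<open>0a\<close> and \<open>1b\<close> are disjoint, so no vertex is
    incremented twice; the second ear avoids \<open>n\<close>, which keeps degree 2.\<close>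
  have deg: "vertex_degree ?K v = (if v = n \<or> v = Suc n then 2
      else vertex_degree G v + (if v \<in> {0, 1, a, b} then 1 else 0))" for v
    unfolding vertex_degree_add_ear[OF two_tree_imp_pair_graph[OF H] arc Sn]
      vertex_degree_add_ear[OF G F(4) n]
    using lt F(6-8) by auto
  have "vertex_degree ?K v \<in> {2, 3} \<and> vertex_degree ?K v < Suc d"
    if "v \<in> {2..<n + 2}" for v
    using that F(11,12) F(13)[of v] \<open>2 < d\<close> unfolding deg
    by (cases "v = n \<or> v = Suc n"; cases "v = a"; cases "v = b") auto
  moreover have "insert (Suc n) (insert n {..<n}) = {..<n + 2}" by auto
  moreover have "two_tree ?K" by (rule two_tree_add_ear[OF H arc Sn])
  ultimately show ?thesis
    using F(2-12) lt unfolding double_fan_def deg by simp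
qed

text \<open>All pages are added first, by the inner induction on \<open>t\<close>; the outer
  induction on \<open>s\<close> then extends with \<open>t\<close> fixed.\<close>

lemma double_fan_exists: "\<exists>a b G. double_fan (4 + t + 2 * s) (3 + t + s) a b G"
proof (induction s)
  case 0
  show ?case
  proof (induction t)
    case 0
    show ?case using double_fan_base by auto
  next
    case (Suc t)
    then show ?case using double_fan_page by fastforce
  qed
next
  case (Suc s)
  then obtain a b G where "double_fan (4 + t + 2 * s) (3 + t + s) a b G" by blast
  from double_fan_extend[OF this] have "\<exists>a b G. double_fan (4 + t + 2 * s + 2) (Suc (3 + t + s)) a b G"
    by blast
  then show ?case by (simp add: add.commute)
qed

lemma double_fan_max_degree:
  assumes "double_fan n d a b G"
  shows "max_degree G = d"
  unfolding max_degree_def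
proof (rule Max_eqI)
  interpret pair_graph G
    using assms by (auto simp: double_fan_def intro: two_tree_imp_pair_graph)
  show "finite (vertex_degree G ` pverts G)" by simp
  show "d \<in> vertex_degree G ` pverts G"
    using assms in_arcsD1[of 0 1] by (auto simp: double_fan_def)
  fix k assume "k \<in> vertex_degree G ` pverts G"
  then obtain v where v: "v < n" "k = vertex_degree G v"
    using assms by (auto simp: double_fan_def)
  have "v = 0 \<or> v = 1 \<or> v \<in> {2..<n}" using v by auto
  then show "k \<le> d"
    using assms v by (auto simp: double_fan_def intro: less_imp_le)
qed

lemma double_fan_core_verts:
  assumes "double_fan n d a b G"
  shows "core_verts G = {0, 1}"
proof -
  interpret pair_graph G
    using assms by (auto simp: double_fan_def intro: two_tree_imp_pair_graph)
  have "0 \<in> pverts G" "1 \<in> pverts G"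
    using assms by (auto simp: double_fan_def dest: in_arcsD1 in_arcsD2)
  moreover have "v = 0 \<or> v = 1" if "v < n" "vertex_degree G v = d" for v
  proof (rule ccontr)
    assume "\<not> (v = 0 \<or> v = 1)"
    then have "v \<in> {2..<n}" using that by auto
    then show False using assms that by (auto simp: double_fan_def)
  qed
  ultimately show ?thesis
    using assms by (auto simp: core_verts_def double_fan_max_degree[OF assms] double_fan_def)
qed

lemma double_fan_strong:
  assumes "double_fan n d a b G"
  shows "strong G"
proof -
  let ?K = "\<lparr>pverts = {0, 1}, parcs = {(0, 1), (1, 0)}\<rparr> :: nat pair_pre_digraph"
  interpret pair_graph G
    using assms by (auto simp: double_fan_def intro: two_tree_imp_pair_graph)
  have "(0, 1) \<in> parcs G" using assms by (simp add: double_fan_def)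
  moreover from this have "(1, 0) \<in> parcs G" using pair_sym_arcs by (auto simp: symmetric_def sym_def)
  \<comment> \<open>Without loops, the arcs induced on \<open>{0, 1}\<close> are just the two
    orientations of the edge 01.\<close>
  moreover have "(0, 0) \<notin> parcs G" "(1, 1) \<notin> parcs G"
    using pair_no_loops by fastforce+
  ultimately have "induce_subgraph (with_proj G) {0, 1} = with_proj ?K"
    by (auto simp: induce_subgraph_def with_proj_def)
  moreover have "complete_digraph 2 (with_proj ?K)"
    unfolding complete_digraph_pair_def by auto
  ultimately show ?thesis
    by (simp add: strong_def double_fan_core_verts[OF assms] numeral_2_eq_2)
qed

theorem theorem4p9:
  fixes n \<Delta> :: nat
  assumes "n \<ge> 4"
    and "\<lceil>(real n + 2) / 2\<rceil> \<le> int \<Delta>"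
    and "\<Delta> \<le> n - 1"
  shows "\<exists>G :: nat pair_pre_digraph.
    bicentral_two_tree n \<Delta> G \<and> strong G \<and> has_tail_set G {2, 3}"
proof -
  have "n + 2 \<le> 2 * \<Delta>"
    using assms(2) by (simp add: ceiling_le_iff)
  \<comment> \<open>These solve the two equations in \<open>st\<close> for \<open>s\<close> and
    \<open>t\<close>. The upper bound on \<open>\<Delta>\<close> makes the natural subtraction in
    \<open>s\<close> exact, and the ceiling bound, restated as
    \<open>n + 2 \<le> 2 * \<Delta>\<close>, does so for \<open>t\<close>.\<close>
  define s t where "s = n - 1 - \<Delta>" and "t = 2 * \<Delta> - n - 2"
  have st: "n = 4 + t + 2 * s" "\<Delta> = 3 + t + s"
    using \<open>n + 2 \<le> 2 * \<Delta>\<close> assms(1,3) by (simp_all add: s_def t_def)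
  obtain a b G where G: "double_fan n \<Delta> a b G"
    using double_fan_exists st by metis
  have "bicentral_two_tree n \<Delta> G"
    using G st double_fan_max_degree[OF G] double_fan_core_verts[OF G]
    by (simp add: central_two_tree_def double_fan_def)
  moreover have "has_tail_set G {2, 3}"
    using G double_fan_core_verts[OF G]
    by (auto simp: has_tail_set_def tail_verts_def double_fan_def)
  ultimately show ?thesis using double_fan_strong[OF G] by blast
qed

end
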